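(* Let $n,q,m$ be positive integers, $\boldsymbol{W}\in\mathbb{R}^{n\times q}$ with $\mathrm{rank}(\boldsymbol{W})=n<q$, $\boldsymbol{T}\in\mathbb{R}^{n\times m}$ with $\mathrm{rank}(\boldsymbol{T})=m<n$, and $\boldsymbol{y}\in\mathbb{R}^n$. Fix $i\in\{1,\dots,n\}$ and let $$\boldsymbol{P}_{\boldsymbol{W}^\dagger\boldsymbol{e}_i}=\frac{\boldsymbol{W}^\dagger\boldsymbol{e}_i\boldsymbol{e}_i^\top(\boldsymbol{W}^{\dagger})^\top}{\boldsymbol{e}_i^\top\boldsymbol{G}_{\boldsymbol{W}}\boldsymbol{e}_i},\qquad \boldsymbol{P}^\perp_{\boldsymbol{W}^\dagger\boldsymbol{e}_i}=\boldsymbol{I}_q-\boldsymbol{P}_{\boldsymbol{W}^\dagger\boldsymbol{e}_i},\qquad \widetilde{\boldsymbol{W}}_i=\boldsymbol{P}^\perp_{\boldsymbol{W}^\dagger\boldsymbol{e}_i}\boldsymbol{W}^\dagger .$$ Then the leave-$i$-out partially regularized least squares coefficients $\widehat{\boldsymbol{\lambda}}^{(\sim i)}\in\mathbb{R}^q$ and $\widehat{\boldsymbol{\tau}}^{(\sim i)}\in\mathbb{R}^m$ (defined in the context) satisfy $$\widehat{\boldsymbol{\lambda}}^{(\sim i)}=\boldsymbol{W}^\top\widetilde{\boldsymbol{W}}_i^\top\boldsymbol{P}^\perp_{\widetilde{\boldsymbol{W}}_i\boldsymbol{T}}\widetilde{\boldsymbol{W}}_i\boldsymbol{y},\qquad \widehat{\boldsymbol{\tau}}^{(\sim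 i)}=(\widetilde{\boldsymbol{W}}_i\boldsymbol{T})^\dagger\widetilde{\boldsymbol{W}}_i\boldsymbol{y}.$$
   Context: Notation: $\boldsymbol{M}^\dagger$ is the Moore–Penrose pseudoinverse of $\boldsymbol{M}$; for $\boldsymbol{M}$ with $k$ rows, $\boldsymbol{P}_{\boldsymbol{M}}=\boldsymbol{M}\boldsymbol{M}^\dagger$ is the orthogonal projection onto the column space of $\boldsymbol{M}$, $\boldsymbol{P}_{\boldsymbol{M}}^\perp=\boldsymbol{I}_k-\boldsymbol{P}_{\boldsymbol{M}}$, and $\boldsymbol{G}_{\boldsymbol{M}}=(\boldsymbol{M}\boldsymbol{M}^\top)^\dagger$. $\boldsymbol{e}_i$ is the $i$-th standard basis vector of $\mathbb{R}^n$. Partially regularized least squares: given a response $\boldsymbol{y}$ and covariates $[\boldsymbol{W},\boldsymbol{T}]$, among all minimizers $(\boldsymbol{\lambda},\boldsymbol{\tau})$ of $\|\boldsymbol{y}-\boldsymbol{W}\boldsymbol{\lambda}-\boldsymbol{T}\boldsymbol{\tau}\|_2^2$ one selects a minimizer of $\|\boldsymbol{\lambda}\|_2^2$ (the coefficients $\boldsymbol{\tau}$ of $\boldsymbol{T}$ are not penalized). The solution is given by the closed form $$\widehat{\boldsymbol{\lambda}}=(\boldsymbol{P}_{\boldsymbol{T}}^\perp\boldsymbol{W})^\dagger\boldsymbol{P}_{\boldsymbol{T}}^\perp\boldsymbol{y},\qquad \widehat{\boldsymbol{\tau}}=(\boldsymbol{W}^\dagger\boldsymbol{T})^\dagger\boldsymbol{W}^\dagger\boldsymbol{y}.$$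 Leave-one-out: $\boldsymbol{W}_{\sim i}\in\mathbb{R}^{(n-1)\times q}$, $\boldsymbol{T}_{\sim i}\in\mathbb{R}^{(n-1)\times m}$, $\boldsymbol{y}_{\sim i}\in\mathbb{R}^{n-1}$ are obtained from $\boldsymbol{W},\boldsymbol{T},\boldsymbol{y}$ by deleting the $i$-th row/entry. The leave-$i$-out coefficients are the partially regularized solution for response $\boldsymbol{y}_{\sim i}$ and covariates $[\boldsymbol{W}_{\sim i},\boldsymbol{T}_{\sim i}]$, i.e. $$\widehat{\boldsymbol{\lambda}}^{(\sim i)}=(\boldsymbol{P}_{\boldsymbol{T}_{\sim i}}^\perp\boldsymbol{W}_{\sim i})^\dagger\boldsymbol{P}_{\boldsymbol{T}_{\sim i}}^\perp\boldsymbol{y}_{\sim i},\qquad \widehat{\boldsymbol{\tau}}^{(\sim i)}=\left((\boldsymbol{W}_{\sim i})^\dagger\boldsymbol{T}_{\sim i}\right)^\dagger(\boldsymbol{W}_{\sim i})^\dagger\boldsymbol{y}_{\sim i}.$$ *)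

theory Defs
  imports "Jordan_Normal_Form.DL_Rank" "Jordan_Normal_Form.Determinant"
begin

text \<open>The Moore--Penrose pseudoinverse of a real matrix, given by the four Penrose conditions,
  which determine it uniquely.\<close>

definition is_pinv :: "real mat \<Rightarrow> real mat \<Rightarrow> bool" where
  "is_pinv M X \<longleftrightarrow>
     X \<in> carrier_mat (dim_col M) (dim_row M) \<and>
     M * X * M = M \<and>
     X * M * X = X \<and>
     transpose_mat (M * X) = M * X \<and>
     transpose_mat (X * M) = X * M"

definition pinv :: "real mat \<Rightarrow> real mat" where
  "pinv M = (THE X. is_pinv M X)"

definition proj :: "real mat \<Rightarrow> real mat" where
  "proj M = M * pinv M"

definition proj_perp :: "real mat \<Rightarrow> real mat" where
  "proj_perp M = 1\<^sub>m (dim_row M) - proj M"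

definition gram_pinv :: "real mat \<Rightarrow> real mat" where
  "gram_pinv M = pinv (M * transpose_mat M)"

text \<open>The closed-form partially regularized least squares coefficients for response \<open>y\<close> and
  covariates \<open>[W, T]\<close>, where only the coefficients of \<open>W\<close> are penalized.\<close>

definition prls_lambda :: "real mat \<Rightarrow> real mat \<Rightarrow> real vec \<Rightarrow> real vec" where
  "prls_lambda W T y = pinv (proj_perp T * W) *\<^sub>v (proj_perp T *\<^sub>v y)"

definition prls_tau :: "real mat \<Rightarrow> real mat \<Rightarrow> real vec \<Rightarrow> real vec" where
  "prls_tau W T y = pinv (pinv W * T) *\<^sub>v (pinv W *\<^sub>v y)"

text \<open>Rows and entries are numbered from 0. The function \<open>insert_index i\<close> enumerates in
  increasing order the indices other than \<open>i\<close>.\<close>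

definition delete_row :: "'a mat \<Rightarrow> nat \<Rightarrow> 'a mat" where
  "delete_row A i = mat (dim_row A - 1) (dim_col A) (\<lambda>(k, j). A $$ (insert_index i k, j))"

definition delete_entry :: "'a vec \<Rightarrow> nat \<Rightarrow> 'a vec" where
  "delete_entry v i = vec (dim_vec v - 1) (\<lambda>k. v $ insert_index i k)"

definition loo_lambda :: "real mat \<Rightarrow> real mat \<Rightarrow> real vec \<Rightarrow> nat \<Rightarrow> real vec" where
  "loo_lambda W T y i = prls_lambda (delete_row W i) (delete_row T i) (delete_entry y i)"

definition loo_tau :: "real mat \<Rightarrow> real mat \<Rightarrow> real vec \<Rightarrow> nat \<Rightarrow> real vec" where
  "loo_tau W T y i = prls_tau (delete_row W i) (delete_row T i) (delete_entry y i)"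

definition proj_pinv_unit :: "real mat \<Rightarrow> nat \<Rightarrow> real mat" where
  "proj_pinv_unit W i =
     (let n = dim_row W;
          e = unit_vec n i;
          E = mat_of_cols n [e]
      in (1 / (e \<bullet> (gram_pinv W *\<^sub>v e))) \<cdot>\<^sub>m
           (pinv W * E * transpose_mat E * transpose_mat (pinv W)))"

definition W_tilde :: "real mat \<Rightarrow> nat \<Rightarrow> real mat" where
  "W_tilde W i = (1\<^sub>m (dim_col W) - proj_pinv_unit W i) * pinv W"

end

theory Submission
  imports Defs
begin

text \<open>Let \<open>S\<close> be the row deletion matrix, so that \<open>S S\<^sup>T = 1\<close> and \<open>S\<^sup>T S = 1 - e e\<^sup>T\<close>, and
  let \<open>B = (S W)\<^sup>\<dagger>\<close>. Since \<open>W W\<^sup>\<dagger> = 1\<close>, the projection in \<open>W_tilde\<close> removes exactly the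
  direction \<open>W\<^sup>\<dagger> e\<close>, so \<open>W_tilde\<close> kills \<open>e\<close> and the Penrose conditions give
  \<open>B = W_tilde S\<^sup>T\<close>, hence \<open>B S = W_tilde\<close>. This is the formula for \<open>\<tau>\<close>. With \<open>V = S W\<close>,
  \<open>U = S T\<close>, \<open>Q\<close> the projection orthogonal to \<open>U\<close> and \<open>R\<close> the projection orthogonal to
  \<open>B U\<close>, the Penrose conditions also give \<open>(Q V)\<^sup>\<dagger> = R B\<close>; together with \<open>R B Q = R B = B V R B\<close>
  this is the formula for \<open>\<lambda>\<close>.\<close>

section \<open>Matrix algebra with side conditions on dimensions\<close>

text \<open>Carrier premises mention dimensions that do not occur in the matrix terms. Dimension
  equations can instead be discharged by the simplifier, so identities between products become
  rewriting with \<open>mat_algebra\<close>.\<close>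

lemma mult_assoc_dim:
  fixes A B C :: "'a::semiring_0 mat"
  shows "dim_col A = dim_row B \<Longrightarrow> dim_col B = dim_row C \<Longrightarrow> A * B * C = A * (B * C)"
  by (rule assoc_mult_mat) auto

lemma mult_minus_distrib_dim:
  fixes A B C :: "'a::ring mat"
  shows "dim_col A = dim_row B \<Longrightarrow> dim_row C = dim_row B \<Longrightarrow> dim_col C = dim_col B \<Longrightarrow>
    A * (B - C) = A * B - A * C"
  by (rule mult_minus_distrib_mat) auto

lemma minus_mult_distrib_dim:
  fixes A B C :: "'a::ring mat"
  shows "dim_col A = dim_row C \<Longrightarrow> dim_row A = dim_row B \<Longrightarrow> dim_col A = dim_col B \<Longrightarrow>
    (A - B) * C = A * C - B * C"
  by (rule minus_mult_distrib_mat) auto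

lemma mult_add_distrib_dim:
  fixes A B C :: "'a::semiring_0 mat"
  shows "dim_col A = dim_row B \<Longrightarrow> dim_row C = dim_row B \<Longrightarrow> dim_col C = dim_col B \<Longrightarrow>
    A * (B + C) = A * B + A * C"
  by (rule mult_add_distrib_mat) auto

lemma add_mult_distrib_dim:
  fixes A B C :: "'a::semiring_0 mat"
  shows "dim_col A = dim_row C \<Longrightarrow> dim_row A = dim_row B \<Longrightarrow> dim_col A = dim_col B \<Longrightarrow>
    (A + B) * C = A * C + B * C"
  by (rule add_mult_distrib_mat) auto

lemma transpose_mult_dim:
  fixes A B :: "'a::comm_semiring_0 mat"
  shows "dim_col A = dim_row B \<Longrightarrow> (A * B)\<^sup>T = B\<^sup>T * A\<^sup>T"
  by (rule transpose_mult) auto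

lemma transpose_minus_dim:
  fixes A B :: "'a::group_add mat"
  shows "dim_row A = dim_row B \<Longrightarrow> dim_col A = dim_col B \<Longrightarrow> (A - B)\<^sup>T = A\<^sup>T - B\<^sup>T"
  by (rule eq_matI) auto

lemma transpose_add_dim:
  fixes A B :: "'a::monoid_add mat"
  shows "dim_row A = dim_row B \<Longrightarrow> dim_col A = dim_col B \<Longrightarrow> (A + B)\<^sup>T = A\<^sup>T + B\<^sup>T"
  by (rule eq_matI) auto

lemma mult_zero_dim:
  fixes A :: "'a::semiring_0 mat"
  shows "dim_col A = n \<Longrightarrow> A * 0\<^sub>m n k = 0\<^sub>m (dim_row A) k"
    "dim_row A = n \<Longrightarrow> 0\<^sub>m k n * A = 0\<^sub>m k (dim_col A)"
  by (auto intro: right_mult_zero_mat left_mult_zero_mat)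

lemma add_zero_dim:
  fixes A :: "'a::group_add mat"
  shows "dim_row A = n \<Longrightarrow> dim_col A = k \<Longrightarrow> A + 0\<^sub>m n k = A"
    "dim_row A = n \<Longrightarrow> dim_col A = k \<Longrightarrow> 0\<^sub>m n k + A = A"
    "dim_row A = n \<Longrightarrow> dim_col A = k \<Longrightarrow> A - 0\<^sub>m n k = A"
    "A - A = 0\<^sub>m (dim_row A) (dim_col A)"
  by (auto intro!: eq_matI)

lemma smult_mult_dim:
  fixes A B :: "'a::comm_semiring_0 mat"
  shows "dim_col A = dim_row B \<Longrightarrow> A * (k \<cdot>\<^sub>m B) = k \<cdot>\<^sub>m (A * B)"
    "dim_col A = dim_row B \<Longrightarrow> (k \<cdot>\<^sub>m A) * B = k \<cdot>\<^sub>m (A * B)"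
  by (auto intro: mult_smult_distrib mult_smult_assoc_mat)

lemmas mat_algebra = mult_assoc_dim mult_minus_distrib_dim minus_mult_distrib_dim
  mult_add_distrib_dim add_mult_distrib_dim transpose_mult_dim transpose_minus_dim
  transpose_add_dim mult_zero_dim add_zero_dim

section \<open>Existence and uniqueness of the pseudoinverse\<close>

text \<open>Symmetry of both products lets one inverse be absorbed into the other: transposing
  \<open>M * X = (M * Y) * (M * X)\<close> gives \<open>M * X = M * Y\<close>, and likewise
  \<open>X * M = Y * M\<close>. Then X = XMX = YMX = YMY = Y.\<close>

lemma is_pinv_unique:
  assumes "is_pinv M X" "is_pinv M Y"
  shows "X = Y"
proof -
  note X = assms(1)[unfolded is_pinv_def] and Y = assms(2)[unfolded is_pinv_def]
  have dims [simp]: "dim_row X = dim_col M" "dim_col X = dim_row M"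
    "dim_row Y = dim_col M" "dim_col Y = dim_row M"
    using X Y by auto
  have MXM: "M * (X * M) = M" and MYM: "M * (Y * M) = M"
    using X Y by (auto simp: mult_assoc_dim)
  have "M * Y * (M * X) = (M * (Y * M)) * X" by (simp add: mult_assoc_dim)
  then have "(M * X)\<^sup>T = ((M * Y) * (M * X))\<^sup>T" by (simp add: MYM)
  also have "\<dots> = (M * X)\<^sup>T * (M * Y)\<^sup>T"
    by (simp add: transpose_mult_dim[of "M * Y"])
  also have "\<dots> = M * X * (M * Y)" using X Y by simp
  also have "\<dots> = M * (X * M) * Y" by (simp add: mult_assoc_dim)
  finally have MX: "M * X = M * Y" using X by (simp add: MXM)
  have "(X * M)\<^sup>T = ((X * M) * (Y * M))\<^sup>T"
    by (simp add: mult_assoc_dim MYM)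
  also have "\<dots> = (Y * M)\<^sup>T * (X * M)\<^sup>T"
    by (simp add: transpose_mult_dim[of "X * M"])
  also have "\<dots> = Y * M * (X * M)" using X Y by simp
  also have "\<dots> = Y * (M * (X * M))" by (simp add: mult_assoc_dim)
  finally have XM: "X * M = Y * M" using X by (simp add: MXM)
  have "X = X * M * X" using X by simp
  also have "\<dots> = Y * (M * X)" unfolding XM by (simp add: mult_assoc_dim)
  also have "\<dots> = Y * M * Y" unfolding MX by (simp add: mult_assoc_dim)
  also have "\<dots> = Y" using Y by simp
  finally show ?thesis .
qed

text \<open>\<open>N\<close> is the pseudoinverse of a nonzero column, its transpose divided by its
  squared length, so \<open>C * N\<close> is the orthogonal projection onto the line of
  \<open>C\<close>. It serves both the Gram-Schmidt step and the projection in
  \<open>W_tilde\<close>.\<close>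

lemma column_left_inverse:
  fixes C :: "real mat"
  assumes C: "C \<in> carrier_mat n 1" and nz: "C \<noteq> 0\<^sub>m n 1"
  defines "N \<equiv> (1 / (col C 0 \<bullet> col C 0)) \<cdot>\<^sub>m C\<^sup>T"
  shows "N * C = 1\<^sub>m 1" "(C * N)\<^sup>T = C * N"
proof -
  have [simp]: "dim_row C = n" "dim_col C = 1" using C by auto
  have "col C 0 \<noteq> 0\<^sub>v n"
  proof
    assume *: "col C 0 = 0\<^sub>v n"
    have "C = 0\<^sub>m n 1"
    proof (rule eq_matI)
      fix a b assume "a < dim_row (0\<^sub>m n 1 :: real mat)" "b < dim_col (0\<^sub>m n 1 :: real mat)"
      then show "C $$ (a, b) = 0\<^sub>m n 1 $$ (a, b)" using arg_cong[OF *, of "\<lambda>v. v $ a"] by simp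
    qed auto
    then show False using nz by simp
  qed
  then have s: "col C 0 \<bullet> col C 0 \<noteq> 0"
    using conjugate_square_eq_0_vec[of "col C 0" n] by (simp add: carrier_vecI)
  show "N * C = 1\<^sub>m 1" using s by (intro eq_matI) (auto simp: N_def scalar_prod_def sum_divide_distrib[symmetric])
  show "(C * N)\<^sup>T = C * N" by (intro eq_matI) (auto simp: N_def scalar_prod_def)
qed

text \<open>Gram--Schmidt on the columns: the orthogonal projection onto the first \<open>k\<close> columns
  is extended by the residual of the next column.\<close>

lemma column_projection_exists:
  fixes M :: "real mat"
  assumes M: "M \<in> carrier_mat n m" and "k \<le> m"
  shows "\<exists>X \<in> carrier_mat m n. (M * X)\<^sup>T = M * X \<and> M * X * (M * X) = M * X \<and>
    (\<forall>E \<in> carrier_mat m 1. (\<forall>j<m. k \<le> j \<longrightarrow> E $$ (j, 0) = 0) \<longrightarrow> M * X * (M * E) = M * E)"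
  using \<open>k \<le> m\<close>
proof (induction k)
  case 0
  \<comment> \<open>With no column available, only the zero combination has to be fixed, so the zero
    matrix is a witness.\<close>
  have E0: "E = 0\<^sub>m m 1" if "E \<in> carrier_mat m 1" "\<forall>j<m. E $$ (j, 0) = 0" for E :: "real mat"
    using that by (intro eq_matI) auto
  have dims: "dim_row M = n" "dim_col M = m" using M by auto
  show ?case
    by (intro bexI[of _ "0\<^sub>m m n"]) (auto simp: mat_algebra dims simp del: One_nat_def dest!: E0)
next
  case (Suc k)
  then obtain X where X: "X \<in> carrier_mat m n" "(M * X)\<^sup>T = M * X" "M * X * (M * X) = M * X"
    and span: "\<And>E. E \<in> carrier_mat m 1 \<Longrightarrow> \<forall>j<m. k \<le> j \<longrightarrow> E $$ (j, 0) = 0 \<Longrightarrow>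
      M * X * (M * E) = M * E"
    by auto
  \<comment> \<open>\<open>U\<close> selects column \<open>k\<close>, which is the new one since
    columns are numbered from 0; \<open>C\<close> is its residual after projection onto the earlier
    columns.\<close>
  define U :: "real mat" where "U = mat m 1 (\<lambda>(j, _). if j = k then 1 else 0)"
  define C where "C = M * U - M * X * (M * U)"
  have [simp]: "dim_row M = n" "dim_col M = m" "dim_row X = m" "dim_col X = n"
    "dim_row U = m" "dim_col U = 1" "dim_row C = n" "dim_col C = 1"
    using M X by (auto simp: U_def C_def)
  have split: "\<exists>F a. F \<in> carrier_mat m 1 \<and> (\<forall>j<m. k \<le> j \<longrightarrow> F $$ (j, 0) = 0) \<and> E = F + a \<cdot>\<^sub>m U"
    if "E \<in> carrier_mat m 1" "\<forall>j<m. Suc k \<le> j \<longrightarrow> E $$ (j, 0) = 0" for E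
    using that
    by (intro exI[of _ "E - E $$ (k, 0) \<cdot>\<^sub>m U"] exI[of _ "E $$ (k, 0)"] conjI)
      (auto simp: U_def intro!: eq_matI dest: le_neq_implies_less)
  \<comment> \<open>By linearity it suffices that the enlarged projection fixes column
    \<open>k\<close> and everything fixed before.\<close>
  have step: "M * Y * (M * E) = M * E"
    if Y: "Y \<in> carrier_mat m n" "M * Y * (M * U) = M * U"
      "\<And>F. F \<in> carrier_mat m 1 \<Longrightarrow> \<forall>j<m. k \<le> j \<longrightarrow> F $$ (j, 0) = 0 \<Longrightarrow> M * Y * (M * F) = M * F"
      and E: "E \<in> carrier_mat m 1" "\<forall>j<m. Suc k \<le> j \<longrightarrow> E $$ (j, 0) = 0" for Y E
  proof -
    obtain F a where F: "F \<in> carrier_mat m 1" "\<forall>j<m. k \<le> j \<longrightarrow> F $$ (j, 0) = 0" "E = F + a \<cdot>\<^sub>m U"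
      using split[OF E] by blast
    have [simp]: "dim_row F = m" "dim_col F = 1" "dim_row Y = m" "dim_col Y = n" using F(1) Y(1) by auto
    have ME: "M * E = M * F + a \<cdot>\<^sub>m (M * U)"
      unfolding F(3) by (simp add: mult_add_distrib_dim smult_mult_dim)
    have "M * Y * (M * E) = M * Y * (M * F) + a \<cdot>\<^sub>m (M * Y * (M * U))"
      unfolding ME by (simp add: mult_add_distrib_dim smult_mult_dim)
    also have "\<dots> = M * E" unfolding ME Y(2) Y(3)[OF F(1,2)] ..
    finally show ?thesis .
  qed
  show ?case
  proof (cases "C = 0\<^sub>m n 1")
    case True
    \<comment> \<open>A zero residual means that column \<open>k\<close> already lies in the range
      of the projection, so \<open>X\<close> is kept.\<close>
    have "M * X * (M * U) = M * U"
    proof (rule eq_matI)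
      fix a b assume "a < dim_row (M * U)" "b < dim_col (M * U)"
      then show "(M * X * (M * U)) $$ (a, b) = (M * U) $$ (a, b)"
        using arg_cong[OF True, of "\<lambda>A. A $$ (a, b)"] by (simp add: C_def del: index_mult_mat(1))
    qed auto
    with step[OF X(1) _ span] show ?thesis using X by blast
  next
    case False
    define N where "N = (1 / (col C 0 \<bullet> col C 0)) \<cdot>\<^sub>m C\<^sup>T"
    have N: "N * C = 1\<^sub>m 1" "(C * N)\<^sup>T = C * N"
      using column_left_inverse[OF _ False] by (auto simp: N_def carrier_matI)
    have [simp]: "dim_row N = 1" "dim_col N = n" by (auto simp: N_def)
    define P where "P = M * X"
    have [simp]: "dim_row P = n" "dim_col P = n" by (auto simp: P_def)
    have P: "P\<^sup>T = P" "P * P = P" using X by (auto simp: P_def)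
    have PP: "P * (P * A) = P * A" if "dim_row A = n" for A
      using that P by (simp add: mult_assoc_dim[symmetric])
    have C': "C = M * U - P * (M * U)" by (simp add: C_def P_def)
    have PC: "P * C = 0\<^sub>m n 1"
      by (simp add: C' mat_algebra PP)
    \<comment> \<open>Symmetry of \<open>P\<close> turns \<open>P * C = 0\<close> into orthogonality
      from the other side, which gives \<open>N * P = 0\<close>.\<close>
    have "(P * C)\<^sup>T = C\<^sup>T * P" using P by (simp add: mat_algebra)
    then have "C\<^sup>T * P = 0\<^sub>m 1 n" using PC by simp
    then have NP: "N * P = 0\<^sub>m 1 n"
      by (simp add: N_def smult_mult_dim)
    have NPa: "N * (P * A) = 0\<^sub>m 1 (dim_col A)" if "dim_row A = n" for A
      using that NP by (simp add: mult_assoc_dim[symmetric] mult_zero_dim)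
    have PCa: "P * (C * A) = 0\<^sub>m n (dim_col A)" if "dim_row A = 1" for A
      using that PC by (simp add: mult_assoc_dim[symmetric] mult_zero_dim)
    have NCa: "N * (C * A) = A" if "dim_row A = 1" for A
      using that N by (simp add: mult_assoc_dim[symmetric])
    \<comment> \<open>The correction is chosen so that \<open>M\<close> maps
      \<open>U - X * (M * U)\<close> to \<open>C\<close>; hence \<open>M * Y\<close> is
      \<open>P + C * N\<close>, a sum of two mutually orthogonal projections.\<close>
    define Y where "Y = X + (U - X * (M * U)) * N"
    have [simp]: "dim_row Y = m" "dim_col Y = n" by (auto simp: Y_def)
    have MY: "M * Y = P + C * N"
      by (simp add: Y_def P_def C_def mat_algebra)
    have Y1: "(M * Y)\<^sup>T = M * Y" unfolding MY using P N by (simp add: transpose_add_dim)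
    have Y2: "M * Y * (M * Y) = M * Y" unfolding MY
      by (simp add: mat_algebra P PCa NPa NCa NP)
    have "N * C = N * (M * U)" by (simp add: C' mat_algebra NPa)
    then have NMU: "N * (M * U) = 1\<^sub>m 1" using N by simp
    have YU: "M * Y * (M * U) = M * U"
    proof -
      have "M * Y * (M * U) = P * (M * U) + C"
        unfolding MY by (simp add: add_mult_distrib_dim mult_assoc_dim NMU)
      also have "\<dots> = M * U" by (intro eq_matI) (auto simp: C' simp del: index_mult_mat(1))
      finally show ?thesis .
    qed
    have YF: "M * Y * (M * F) = M * F"
      if F: "F \<in> carrier_mat m 1" "\<forall>j<m. k \<le> j \<longrightarrow> F $$ (j, 0) = 0" for F
    proof -
      have PF: "P * (M * F) = M * F" using span[OF F] by (simp add: P_def)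
      have [simp]: "dim_row F = m" "dim_col F = 1" using F by auto
      have "N * (M * F) = N * (P * (M * F))" by (simp add: PF)
      also have "\<dots> = 0\<^sub>m 1 1" by (simp add: NPa)
      finally show ?thesis unfolding MY by (simp add: mat_algebra PF)
    qed
    have Y: "Y \<in> carrier_mat m n" by (rule carrier_matI) simp_all
    have "M * Y * (M * E) = M * E"
      if "E \<in> carrier_mat m 1" "\<forall>j<m. Suc k \<le> j \<longrightarrow> E $$ (j, 0) = 0" for E
      by (rule step[OF Y YU YF that])
    with Y Y1 Y2 show ?thesis by blast
  qed
qed

text \<open>Taking all columns in the Gram-Schmidt construction makes the support condition vacuous.
  Applying the projection to each standard unit column then gives \<open>M * X * M = M\<close>
  column by column.\<close>

lemma symmetric_projection_exists:
  fixes M :: "real mat"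
  shows "\<exists>X \<in> carrier_mat (dim_col M) (dim_row M). (M * X)\<^sup>T = M * X \<and> M * X * M = M"
proof -
  obtain X where X: "X \<in> carrier_mat (dim_col M) (dim_row M)" "(M * X)\<^sup>T = M * X"
    and *: "\<forall>E \<in> carrier_mat (dim_col M) 1.
      (\<forall>j<dim_col M. dim_col M \<le> j \<longrightarrow> E $$ (j, 0) = 0) \<longrightarrow> M * X * (M * E) = M * E"
    using column_projection_exists[OF carrier_matI[OF refl refl] order_refl, of M] by blast
  have span: "M * X * (M * E) = M * E" if "E \<in> carrier_mat (dim_col M) 1" for E
    by (rule *[rule_format, OF that]) simp
  have [simp]: "dim_row X = dim_col M" "dim_col X = dim_row M" using X(1) by auto
  have "M * X * M = M"
  proof (rule eq_matI)
    fix a b assume ab: "a < dim_row M" "b < dim_col M"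
    define E :: "real mat" where "E = mat_of_cols (dim_col M) [unit_vec (dim_col M) b]"
    have E: "E \<in> carrier_mat (dim_col M) 1" by (auto simp: E_def intro: carrier_matI)
    have Ecol: "(A * E) $$ (a, 0) = A $$ (a, b)"
      if "A \<in> carrier_mat (dim_row M) (dim_col M)" for A
      using that ab by (simp add: E_def)
    have "(M * X * M) $$ (a, b) = (M * X * M * E) $$ (a, 0)"
      by (rule Ecol[symmetric], rule carrier_matI) simp_all
    also have "M * X * M * E = M * E" using span[OF E] E by (simp add: mult_assoc_dim)
    also have "(M * E) $$ (a, 0) = M $$ (a, b)" by (rule Ecol, rule carrier_matI) simp_all
    finally show "(M * X * M) $$ (a, b) = M $$ (a, b)" .
  qed (use X in auto)
  then show ?thesis using X by blast
qed

text \<open>Urquhart's formula: let \<open>X\<close> satisfy MXM = M with MX symmetric, and let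
  \<open>Y\<close> satisfy MYM = M with YM symmetric. Then YMX is the pseudoinverse, because its
  products with \<open>M\<close> collapse to MX and YM.\<close>

lemma is_pinv_exists: "\<exists>X. is_pinv M X"
proof -
  obtain X where X: "X \<in> carrier_mat (dim_col M) (dim_row M)" "(M * X)\<^sup>T = M * X" "M * X * M = M"
    using symmetric_projection_exists by blast
  obtain Z where Z: "Z \<in> carrier_mat (dim_row M) (dim_col M)" "(M\<^sup>T * Z)\<^sup>T = M\<^sup>T * Z" "M\<^sup>T * Z * M\<^sup>T = M\<^sup>T"
    using symmetric_projection_exists[of "M\<^sup>T"] by auto
  \<comment> \<open>Transposing a one-sided solution for the transpose of \<open>M\<close> moves the
    symmetry condition to the product \<open>Y * M\<close>.\<close>
  define Y where "Y = Z\<^sup>T"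
  have [simp]: "dim_row X = dim_col M" "dim_col X = dim_row M"
    "dim_row Y = dim_col M" "dim_col Y = dim_row M"
    using X Z by (auto simp: Y_def)
  have YM: "Y * M = M\<^sup>T * Z" using Z by (simp add: Y_def transpose_mult_dim)
  have "(M\<^sup>T * Z * M\<^sup>T)\<^sup>T = M * (Y * M)"
    using Z(1) by (simp add: mat_algebra Y_def)
  then have MYM: "M * (Y * M) = M" using Z(3) by simp
  have YMT: "(Y * M)\<^sup>T = Y * M" using Z by (simp add: YM)
  have MXM: "M * (X * M) = M" using X(3) by (simp add: mult_assoc_dim)
  have MYMX: "M * (Y * (M * X)) = M * X"
    using arg_cong[OF MYM, of "\<lambda>A. A * X"] by (simp add: mult_assoc_dim)
  have "is_pinv M (Y * (M * X))"
    unfolding is_pinv_def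
  proof (intro conjI)
    show "Y * (M * X) \<in> carrier_mat (dim_col M) (dim_row M)" by (rule carrier_matI) simp_all
  qed (simp_all add: mult_assoc_dim MXM MYM MYMX X(2) YMT)
  then show ?thesis by blast
qed

lemma is_pinv_pinv: "is_pinv M (pinv M)"
proof -
  obtain X where "is_pinv M X" using is_pinv_exists by blast
  then show ?thesis unfolding pinv_def by (rule theI) (erule is_pinv_unique, fact)
qed

text \<open>Every explicit pseudoinverse below is obtained this way, by checking the Penrose
  conditions for a candidate.\<close>

lemma pinv_eqI: "is_pinv M X \<Longrightarrow> pinv M = X"
  by (rule is_pinv_unique[OF is_pinv_pinv])

lemma
  shows dim_row_pinv [simp]: "dim_row (pinv M) = dim_col M"
    and dim_col_pinv [simp]: "dim_col (pinv M) = dim_row M"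
    and mult_pinv_mult: "M * (pinv M * M) = M"
    and transpose_mult_pinv: "(M * pinv M)\<^sup>T = M * pinv M"
    and transpose_pinv_mult: "(pinv M * M)\<^sup>T = pinv M * M"
proof -
  note P = is_pinv_pinv[of M, unfolded is_pinv_def]
  show dims: "dim_row (pinv M) = dim_col M" "dim_col (pinv M) = dim_row M" using P by auto
  show "M * (pinv M * M) = M"
    using P mult_assoc_dim[of M "pinv M" M] dims by auto
  show "(M * pinv M)\<^sup>T = M * pinv M" "(pinv M * M)\<^sup>T = pinv M * M" using P by auto
qed

section \<open>Full row rank\<close>

text \<open>The vectors fixed by \<open>W * pinv W\<close> form a submodule containing every column
  of \<open>W\<close>, since \<open>W * pinv W * W = W\<close>. Full row rank makes the columns span
  the whole space, so the projection is the identity.\<close>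

lemma right_inverse_of_full_row_rank:
  assumes W: "W \<in> carrier_mat n q" and rank: "vec_space.rank n W = n"
  shows "W * pinv W = 1\<^sub>m n"
proof -
  interpret vec_space "TYPE(real)" n .
  have [simp]: "dim_row W = n" "dim_col W = q" using W by auto
  \<comment> \<open>The rank is the size of a maximal independent set of columns; having
    \<open>n\<close> elements, this set is a basis.\<close>
  obtain S where S: "maximal S (\<lambda>T. T \<subseteq> set (cols W) \<and> lin_indpt T)"
    using maximal_exists_superset[of "set (cols W)" "\<lambda>T. T \<subseteq> set (cols W) \<and> lin_indpt T" "{}"]
    by (auto simp: finite_lin_indpt2)
  then have Sc: "S \<subseteq> set (cols W)" "lin_indpt S" by (auto simp: maximal_def)
  have SV: "S \<subseteq> carrier_vec n" using Sc(1) cols_dim[of W] by auto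
  have "card S = n" using rank_card_indpt[OF W S] rank by simp
  then have "basis S"
    using dim_li_is_basis[of S] Sc SV fin_dim dim_is_n finite_subset[OF Sc(1)] by simp
  then have gen: "span S = carrier_vec n" by (simp add: basis_def)
  define F where "F = {v \<in> carrier_vec n. W * pinv W *\<^sub>v v = v}"
  have P: "W * pinv W \<in> carrier_mat n n" by (auto intro: carrier_matI)
  have P0: "W * pinv W *\<^sub>v 0\<^sub>v n = 0\<^sub>v n" by (rule eq_vecI) (auto simp: scalar_prod_def)
  have "S \<subseteq> F"
  proof
    fix v assume "v \<in> S"
    then obtain j where j: "j < q" "v = col W j" using Sc(1) by (auto simp: cols_def)
    have "W * pinv W *\<^sub>v col W j = col (W * pinv W * W) j"
      using j by (simp add: col_mult2[OF P W])
    then show "v \<in> F" using j by (auto simp: F_def mult_assoc_dim mult_pinv_mult intro!: carrier_vecI)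
  qed
  moreover have "submodule class_ring F V"
    by (unfold_locales)
      (auto simp: F_def mult_add_distrib_mat_vec[OF P] mult_mat_vec[OF P] P0 class_ring_simps)
  ultimately have "carrier_vec n \<subseteq> F" unfolding gen[symmetric] by (rule span_is_subset)
  then have "unit_vec n j \<in> F" for j by (rule subsetD) simp
  then have id: "W * pinv W *\<^sub>v unit_vec n j = unit_vec n j" for j by (simp add: F_def)
  show ?thesis
  proof (rule eq_matI)
    fix a b assume ab: "a < dim_row (1\<^sub>m n :: real mat)" "b < dim_col (1\<^sub>m n :: real mat)"
    then have "(W * pinv W) $$ (a, b) = (W * pinv W *\<^sub>v unit_vec n b) $ a"
      by simp
    then show "(W * pinv W) $$ (a, b) = 1\<^sub>m n $$ (a, b)" using id ab by simp
  qed auto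
qed

section \<open>Deletion of a row\<close>

lemma insert_index_less: "k < n - 1 \<Longrightarrow> insert_index i k < n"
  by (auto simp: insert_index_def)

lemma insert_index_eq_iff: "insert_index i k = insert_index i l \<longleftrightarrow> k = l"
  by (metis delete_insert_index)

lemma insert_index_neq: "insert_index i k \<noteq> i"
  by (auto simp: insert_index_def)

lemma row_delete_row_one:
  "k < n - 1 \<Longrightarrow> row (delete_row (1\<^sub>m n) i) k = (unit_vec n (insert_index i k) :: 'a::semiring_1 vec)"
  by (rule eq_vecI) (auto simp: delete_row_def insert_index_less unit_vec_def)

lemma dim_delete_row [simp]:
  "dim_row (delete_row A i) = dim_row A - 1" "dim_col (delete_row A i) = dim_col A"
  by (auto simp: delete_row_def)

text \<open>Writing deletion as left multiplication by a fixed matrix, the identity with row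
  \<open>i\<close> removed, brings it within reach of the matrix algebra.\<close>

lemma delete_row_eq_mult:
  fixes A :: "'a::semiring_1 mat"
  shows "delete_row A i = delete_row (1\<^sub>m (dim_row A)) i * A"
  by (rule eq_matI) (auto simp: row_delete_row_one insert_index_less, simp add: delete_row_def insert_index_less)

lemma delete_entry_eq_mult:
  fixes v :: "'a::semiring_1 vec"
  shows "delete_entry v i = delete_row (1\<^sub>m (dim_vec v)) i *\<^sub>v v"
  by (rule eq_vecI) (auto simp: row_delete_row_one insert_index_less delete_entry_def)

text \<open>The rows of \<open>S\<close> are distinct unit vectors, hence orthonormal.\<close>

lemma delete_row_one_mult_transpose:
  fixes n i :: nat
  defines "S \<equiv> delete_row (1\<^sub>m n) i :: 'a::semiring_1 mat"
  shows "S * S\<^sup>T = 1\<^sub>m (n - 1)"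
  by (rule eq_matI)
    (auto simp: S_def row_delete_row_one insert_index_less insert_index_eq_iff)

lemma delete_row_one_mult_unit:
  fixes n i :: nat
  shows "i < n \<Longrightarrow> delete_row (1\<^sub>m n) i * mat_of_cols n [unit_vec n i] = (0\<^sub>m (n - 1) 1 :: 'a::semiring_1 mat)"
  by (rule eq_matI)
    (auto simp: row_delete_row_one insert_index_less insert_index_neq insert_index_neq[symmetric])

text \<open>Column \<open>i\<close> of \<open>S\<close> vanishes and the other columns are
  orthonormal, so the product is the projection that erases coordinate \<open>i\<close>.\<close>

lemma transpose_mult_delete_row_one:
  fixes n i :: nat
  defines "S \<equiv> delete_row (1\<^sub>m n) i :: 'a::ring_1 mat"
    and "E \<equiv> mat_of_cols n [unit_vec n i]"
  assumes i: "i < n"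
  shows "S\<^sup>T * S = 1\<^sub>m n - E * E\<^sup>T"
proof (rule eq_matI)
  fix a b assume "a < dim_row (1\<^sub>m n - E * E\<^sup>T)" "b < dim_col (1\<^sub>m n - E * E\<^sup>T)"
  then have ab: "a < n" "b < n" by (auto simp: E_def)
  have col: "col S c = (if c = i then 0\<^sub>v (n - 1) else unit_vec (n - 1) (delete_index i c))"
    if "c < n" for c
    using that i
    by (intro eq_vecI)
      (auto simp: S_def delete_row_def insert_index_def delete_index_def unit_vec_def)
  have "delete_index i a = delete_index i b \<longleftrightarrow> a = b" if "a \<noteq> i" "b \<noteq> i"
    using that by (auto simp: delete_index_def split: if_splits)
  moreover have "delete_index i c < n - 1" if "c \<noteq> i" "c < n" for c
    using that i by (auto simp: delete_index_def)
  ultimately have cols: "col S a \<bullet> col S b = (if a = b then 1 else 0) - (if a = i \<and> b = i then 1 else 0)"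
    using ab by (auto simp: col)
  have dims: "dim_row S = n - 1" "dim_col S = n" by (simp_all add: S_def)
  have "(S\<^sup>T * S) $$ (a, b) = col S a \<bullet> col S b" using ab by (simp add: dims)
  moreover have "(1\<^sub>m n - E * E\<^sup>T) $$ (a, b) = (if a = b then 1 else 0) - (if a = i \<and> b = i then 1 else 0)"
    using ab by (simp add: E_def scalar_prod_def mat_of_cols_def unit_vec_def)
  ultimately show "(S\<^sup>T * S) $$ (a, b) = (1\<^sub>m n - E * E\<^sup>T) $$ (a, b)" by (simp only: cols)
qed (auto simp: S_def E_def)

section \<open>The leave-one-out coefficients\<close>

lemma mult_mat_vec_assoc_dim:
  fixes A B :: "'a::comm_semiring_0 mat"
  shows "dim_col A = dim_row B \<Longrightarrow> dim_col B = dim_vec v \<Longrightarrow> A *\<^sub>v (B *\<^sub>v v) = A * B *\<^sub>v v"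
  by (rule assoc_mult_mat_vec[symmetric]) (auto intro: carrier_vecI)

text \<open>The candidate for the pseudoinverse of \<open>S * W\<close> is
  \<open>W_tilde W i\<close> times the transpose of \<open>S\<close>. Because
  \<open>W_tilde W i\<close> annihilates the deleted unit vector, multiplying this candidate by
  \<open>S\<close> recovers \<open>W_tilde W i\<close>.\<close>

lemma
  fixes W :: "real mat" and i :: nat
  defines "n \<equiv> dim_row W"
  defines "S \<equiv> delete_row (1\<^sub>m n) i"
  assumes right_inv: "W * pinv W = 1\<^sub>m n" and i: "i < n"
  shows W_tilde_eq_pinv_delete_row: "W_tilde W i = pinv (S * W) * S"
    and delete_row_right_inverse: "S * W * pinv (S * W) = 1\<^sub>m (n - 1)"
proof -
  define A where "A = pinv W"
  define E :: "real mat" where "E = mat_of_cols n [unit_vec n i]"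
  define C where "C = A * E"
  define N where "N = (1 / (col C 0 \<bullet> col C 0)) \<cdot>\<^sub>m C\<^sup>T"
  define q where "q = dim_col W"
  have [simp]: "dim_row W = n" "dim_col W = q" "dim_row A = q" "dim_col A = n"
    "dim_row E = n" "dim_col E = 1" "dim_row C = q" "dim_col C = 1"
    "dim_row N = 1" "dim_col N = q" "dim_row S = n - 1" "dim_col S = n"
    by (simp_all add: n_def A_def E_def C_def N_def q_def S_def)
  have WA: "W * A = 1\<^sub>m n" using right_inv by (simp add: A_def)
  have WAa: "W * (A * B) = B" if "dim_row B = n" for B
    using that WA by (simp add: mult_assoc_dim[symmetric])
  have AWT: "(A * W)\<^sup>T = A * W" by (simp add: A_def transpose_pinv_mult)
  have WC: "W * C = E" by (simp add: C_def WAa)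
  \<comment> \<open>Since \<open>W\<close> maps \<open>C\<close> to a unit vector, the denominator
    in the projection is nonzero.\<close>
  have "C \<noteq> 0\<^sub>m q 1"
  proof
    assume "C = 0\<^sub>m q 1"
    then have "E = 0\<^sub>m n 1" using WC by (simp add: mult_zero_dim)
    then have "E $$ (i, 0) = 0" using i by simp
    then show False using i by (simp add: E_def mat_of_cols_def)
  qed
  then have NC: "N * C = 1\<^sub>m 1" and CNT: "(C * N)\<^sup>T = C * N"
    using column_left_inverse[OF carrier_matI, of C q] by (simp_all add: N_def)
  \<comment> \<open>From \<open>W * A = 1\<close> and the symmetry of \<open>A * W\<close>, the Gram
    matrix is invertible and this product is its two-sided inverse.\<close>
  have gram: "gram_pinv W = A\<^sup>T * A"
    unfolding gram_pinv_def
  proof (rule pinv_eqI)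
    have T: "W\<^sup>T * A\<^sup>T = A * W" using AWT by (simp add: transpose_mult_dim)
    have T': "A\<^sup>T * W\<^sup>T = 1\<^sub>m n" using arg_cong[OF WA, of transpose_mat] by (simp add: transpose_mult_dim)
    have "W * W\<^sup>T * (A\<^sup>T * A) = W * (W\<^sup>T * A\<^sup>T) * A" by (simp add: mult_assoc_dim)
    then have 1: "W * W\<^sup>T * (A\<^sup>T * A) = 1\<^sub>m n" by (simp add: T mult_assoc_dim WA)
    have "A\<^sup>T * A * (W * W\<^sup>T) = A\<^sup>T * (A * W) * W\<^sup>T" by (simp add: mult_assoc_dim)
    also have "\<dots> = A\<^sup>T * W\<^sup>T * (A\<^sup>T * W\<^sup>T)" unfolding T[symmetric] by (simp add: mult_assoc_dim)
    finally have 2: "A\<^sup>T * A * (W * W\<^sup>T) = 1\<^sub>m n" by (simp add: T')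
    show "is_pinv (W * W\<^sup>T) (A\<^sup>T * A)"
      unfolding is_pinv_def 1 2 by (auto intro: carrier_matI)
  qed
  have col_C: "col C 0 = A *\<^sub>v unit_vec n i"
    by (rule eq_vecI) (simp_all add: C_def E_def)
  have "unit_vec n i \<bullet> (gram_pinv W *\<^sub>v unit_vec n i) = unit_vec n i \<bullet> (A\<^sup>T *\<^sub>v (A *\<^sub>v unit_vec n i))"
    by (simp add: gram mult_mat_vec_assoc_dim)
  also have "\<dots> = (A\<^sup>T *\<^sub>v col C 0) \<bullet> unit_vec n i"
    unfolding col_C by (rule comm_scalar_prod[of _ n]) (auto intro: carrier_vecI)
  also have "\<dots> = col C 0 \<bullet> (A *\<^sub>v unit_vec n i)"
    by (rule transpose_vec_mult_scalar[of _ q n]) (auto intro: carrier_vecI carrier_matI)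
  \<comment> \<open>The denominator in \<open>proj_pinv_unit\<close> is the squared length of
    \<open>C\<close>, so that matrix is the orthogonal projection \<open>C * N\<close>.\<close>
  finally have g: "unit_vec n i \<bullet> (gram_pinv W *\<^sub>v unit_vec n i) = col C 0 \<bullet> col C 0"
    unfolding col_C .
  have "A * E * E\<^sup>T * A\<^sup>T = C * C\<^sup>T" by (simp add: C_def mat_algebra)
  then have proj: "proj_pinv_unit W i = C * N"
    unfolding proj_pinv_unit_def Let_def n_def[symmetric] g E_def[symmetric] A_def[symmetric]
    by (simp add: N_def smult_mult_dim)
  have Wt: "W_tilde W i = A - C * (N * A)"
    by (simp add: W_tilde_def proj A_def[symmetric] mat_algebra)
  have [simp]: "dim_row (W_tilde W i) = q" "dim_col (W_tilde W i) = n" by (simp_all add: Wt)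
  have WtE: "W_tilde W i * E = 0\<^sub>m q 1"
    by (simp add: Wt mat_algebra C_def[symmetric] NC)
  have SE: "S * E = 0\<^sub>m (n - 1) 1"
    using delete_row_one_mult_unit[OF i] by (simp add: S_def E_def)
  have SST: "S * S\<^sup>T = 1\<^sub>m (n - 1)"
    by (simp add: S_def delete_row_one_mult_transpose)
  have STS: "S\<^sup>T * S = 1\<^sub>m n - E * E\<^sup>T"
    using transpose_mult_delete_row_one[OF i] by (simp add: S_def E_def)
  define X where "X = W_tilde W i * S\<^sup>T"
  have [simp]: "dim_row X = q" "dim_col X = n - 1" by (simp_all add: X_def)
  have "W_tilde W i * (E * E\<^sup>T) = W_tilde W i * E * E\<^sup>T"
    by (simp add: mult_assoc_dim)
  then have WtEE: "W_tilde W i * (E * E\<^sup>T) = 0\<^sub>m q n" by (simp add: WtE mult_zero_dim)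
  \<comment> \<open>The product of the transpose of \<open>S\<close> with \<open>S\<close> differs
    from the identity only by \<open>E\<close> times its transpose, which \<open>W_tilde W i\<close>
    kills.\<close>
  have XS: "X * S = W_tilde W i"
    by (simp add: X_def mat_algebra STS WtEE)
  have "S * W * X = S * (W * W_tilde W i) * S\<^sup>T"
    by (simp add: X_def mult_assoc_dim)
  also have "W * W_tilde W i = 1\<^sub>m n - E * (N * A)"
    by (simp add: Wt mult_minus_distrib_dim WA mult_assoc_dim[of W C, symmetric] WC)
  also have "S * (1\<^sub>m n - E * (N * A)) = S - S * E * (N * A)"
    by (simp add: mat_algebra)
  also have "\<dots> = S" by (simp add: SE mult_zero_dim add_zero_dim)
  finally have VX: "S * W * X = 1\<^sub>m (n - 1)" by (simp add: SST)
  \<comment> \<open>\<open>A * W\<close> is the orthogonal projection onto the row space of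
    \<open>W\<close>, which contains \<open>C\<close>. Transposing shows that it is absorbed from
    the right too, so \<open>X * (S * W)\<close> becomes a difference of symmetric matrices.\<close>
  have "A * W * (C * N) = C * N"
    by (simp add: mult_assoc_dim mult_assoc_dim[of W C, symmetric] WC)
      (simp add: C_def mult_assoc_dim)
  then have "(C * N)\<^sup>T * (A * W)\<^sup>T = (C * N)\<^sup>T"
    by (simp add: transpose_mult_dim[of "A * W" "C * N", symmetric] del: transpose_mult)
  then have CNAW: "C * N * (A * W) = C * N" by (simp add: CNT AWT)
  have "X * (S * W) = X * S * W" by (simp add: mult_assoc_dim)
  also have "\<dots> = A * W - C * N * (A * W)" unfolding XS Wt by (simp add: mat_algebra)
  finally have XV: "X * (S * W) = A * W - C * N" by (simp add: CNAW)
  have "X * (S * W) * X = X * (S * W * X)" by (simp add: mult_assoc_dim)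
  then have XVX: "X * (S * W) * X = X" by (simp add: VX)
  have sym: "(A * W - C * N)\<^sup>T = A * W - C * N"
    by (simp add: transpose_minus_dim AWT CNT)
  have "is_pinv (S * W) X"
    unfolding is_pinv_def VX XVX unfolding XV sym by (auto intro: carrier_matI)
  then have X: "pinv (S * W) = X" by (rule pinv_eqI)
  then show "W_tilde W i = pinv (S * W) * S" by (simp add: X XS)
  show "S * W * pinv (S * W) = 1\<^sub>m (n - 1)" by (simp add: X VX)
qed

text \<open>Everything rests on three facts: \<open>Q\<close> kills \<open>U\<close>,
  \<open>R\<close> kills \<open>B * U\<close>, and \<open>V * B\<close> is the identity. They yield
  \<open>Q * V * (R * B) = Q\<close> and \<open>R * B * (Q * V) = R * (B * V)\<close>. The latter is
  symmetric because \<open>R\<close> commutes with the projection \<open>B * V\<close>, whose range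
  contains that of \<open>B * U\<close>.\<close>

lemma
  fixes U V :: "real mat"
  assumes right_inv: "V * pinv V = 1\<^sub>m (dim_row V)" and dim: "dim_row U = dim_row V"
  defines "R \<equiv> proj_perp (pinv V * U)"
  shows pinv_proj_perp_mult: "pinv (proj_perp U * V) = R * pinv V"
    and proj_perp_pinv_mult_proj_perp: "R * pinv V * proj_perp U = R * pinv V"
    and pinv_mult_proj_perp: "pinv V * V * R * pinv V = R * pinv V"
proof -
  define B where "B = pinv V"
  define D where "D = pinv (B * U)"
  define Q where "Q = proj_perp U"
  define n where "n = dim_row V"
  define q where "q = dim_col V"
  define m where "m = dim_col U"
  have [simp]: "dim_row V = n" "dim_col V = q" "dim_row U = n" "dim_col U = m"
    "dim_row B = q" "dim_col B = n" "dim_row D = m" "dim_col D = q"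
    by (simp_all add: n_def q_def m_def dim B_def D_def)
  have R: "R = 1\<^sub>m q - B * (U * D)"
    by (simp add: R_def proj_perp_def proj_def B_def[symmetric] D_def[symmetric] mult_assoc_dim)
  have Q: "Q = 1\<^sub>m n - U * pinv U"
    by (simp add: Q_def proj_perp_def proj_def)
  have [simp]: "dim_row R = q" "dim_col R = q" "dim_row Q = n" "dim_col Q = n"
    by (simp_all add: R Q)
  have VB: "V * B = 1\<^sub>m n" using right_inv by (simp add: B_def)
  have VBa: "V * (B * A) = A" if "dim_row A = n" for A
    using that VB by (simp add: mult_assoc_dim[symmetric])
  have QU: "Q * U = 0\<^sub>m n m"
    by (simp add: Q mat_algebra mult_pinv_mult)
  have QUa: "Q * (U * A) = 0\<^sub>m n (dim_col A)" if "dim_row A = m" for A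
    using that QU by (simp add: mult_assoc_dim[symmetric] mult_zero_dim)
  have QQ: "Q * Q = Q"
    by (subst (2) Q) (simp add: mat_algebra QUa)
  have QT: "Q\<^sup>T = Q"
    by (simp add: Q transpose_minus_dim transpose_mult_pinv)
  have BUDBU: "B * (U * (D * (B * U))) = B * U"
    using mult_pinv_mult[of "B * U"] by (simp add: D_def[symmetric] mult_assoc_dim)
  have RBU: "R * (B * U) = 0\<^sub>m q m"
    by (simp add: R mat_algebra BUDBU)
  have "R * B * (U * pinv U) = R * (B * U) * pinv U" by (simp add: mult_assoc_dim)
  then have "R * B * (U * pinv U) = 0\<^sub>m q n" by (simp add: RBU mult_zero_dim)
  then have RBQ: "R * B * Q = R * B"
    by (simp add: Q mult_minus_distrib_dim add_zero_dim)
  \<comment> \<open>\<open>R * B\<close> inverts \<open>V\<close> from the right up to a term with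
    range in the column space of \<open>U\<close>; \<open>Q\<close> removes that term.\<close>
  have VRB: "V * (R * B) = 1\<^sub>m n - U * (D * B)"
    by (simp add: R mat_algebra VBa VB)
  have QVRB: "Q * V * (R * B) = Q"
  proof -
    have "Q * V * (R * B) = Q * (V * (R * B))" by (simp add: mult_assoc_dim)
    also have "\<dots> = Q" unfolding VRB by (simp add: mat_algebra QUa)
    finally show ?thesis .
  qed
  have BVT: "(B * V)\<^sup>T = B * V" by (simp add: B_def transpose_pinv_mult)
  have BUDT: "(B * (U * D))\<^sup>T = B * (U * D)"
    using transpose_mult_pinv[of "B * U"] by (simp add: D_def[symmetric] mult_assoc_dim)
  have BVR: "B * V * R = B * V - B * (U * D)"
    by (simp add: R mat_algebra VBa)
  have RT: "R\<^sup>T = R" by (simp add: R transpose_minus_dim BUDT)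
  \<comment> \<open>\<open>B * V * R\<close> is a difference of symmetric matrices, so transposing
    it shows that the two projections commute.\<close>
  have "(B * V * R)\<^sup>T = R * (B * V)"
    by (simp add: transpose_mult_dim[of "B * V"] BVT RT)
  then have RBV: "R * (B * V) = B * V - B * (U * D)"
    by (simp add: BVR transpose_minus_dim BVT BUDT)
  have RBVT: "(R * (B * V))\<^sup>T = R * (B * V)"
    by (simp add: RBV transpose_minus_dim BVT BUDT)
  have RBQV: "R * B * (Q * V) = R * (B * V)"
  proof -
    have "R * B * (Q * V) = R * B * Q * V" by (simp add: mult_assoc_dim)
    then show ?thesis by (simp add: RBQ mult_assoc_dim)
  qed
  have "is_pinv (Q * V) (R * B)"
    unfolding is_pinv_def QVRB RBQV RBVT
  proof (intro conjI)
    show "R * B \<in> carrier_mat (dim_col (Q * V)) (dim_row (Q * V))"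
      by (rule carrier_matI) simp_all
    show "Q * (Q * V) = Q * V" by (simp add: mult_assoc_dim[symmetric] QQ)
    have "R * (B * V) * (R * B) = R * (B * (V * (R * B)))" by (simp add: mult_assoc_dim)
    also have "\<dots> = R * B - R * (B * U) * (D * B)" unfolding VRB by (simp add: mat_algebra)
    also have "\<dots> = R * B" by (simp add: RBU mult_zero_dim add_zero_dim)
    finally show "R * (B * V) * (R * B) = R * B" .
  qed (simp_all add: QT)
  then show "pinv (proj_perp U * V) = R * pinv V"
    unfolding Q_def[symmetric] B_def[symmetric] by (rule pinv_eqI)
  show "R * pinv V * proj_perp U = R * pinv V"
    unfolding Q_def[symmetric] B_def[symmetric] by (rule RBQ)
  have "B * V * R * B = B - B * (U * D) * B"
    unfolding BVR by (simp add: mat_algebra VB)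
  also have "\<dots> = R * B" by (simp add: R minus_mult_distrib_dim)
  finally show "pinv V * V * R * pinv V = R * pinv V" unfolding B_def[symmetric] .
qed

theorem proposition1:
  fixes n q m i :: nat
    and W T :: "real mat"
    and y :: "real vec"
  assumes "0 < n" "0 < q" "0 < m"
    and "W \<in> carrier_mat n q"
    and "vec_space.rank n W = n" "n < q"
    and "T \<in> carrier_mat n m"
    and "vec_space.rank n T = m" "m < n"
    and "y \<in> carrier_vec n"
    and "i < n"
  shows "loo_lambda W T y i =
           transpose_mat W *\<^sub>v (transpose_mat (W_tilde W i) *\<^sub>v
             (proj_perp (W_tilde W i * T) *\<^sub>v (W_tilde W i *\<^sub>v y)))
       \<and> loo_tau W T y i = pinv (W_tilde W i * T) *\<^sub>v (W_tilde W i *\<^sub>v y)"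
proof -
  have [simp]: "dim_row W = n" "dim_col W = q" "dim_row T = n" "dim_col T = m" "dim_vec y = n"
    using assms by auto
  define S :: "real mat" where "S = delete_row (1\<^sub>m n) i"
  define V where "V = S * W"
  define B where "B = pinv V"
  define Z where "Z = W_tilde W i"
  define R where "R = proj_perp (B * (S * T))"
  have [simp]: "dim_row S = n - 1" "dim_col S = n" "dim_row V = n - 1" "dim_col V = q"
    "dim_row B = q" "dim_col B = n - 1" "dim_row R = q" "dim_col R = q"
    by (simp_all add: S_def V_def B_def R_def proj_perp_def proj_def)
  have right_inv: "W * pinv W = 1\<^sub>m n"
    using right_inverse_of_full_row_rank assms by blast
  have Z: "Z = B * S"
    using W_tilde_eq_pinv_delete_row[of W i] right_inv assms by (simp add: Z_def B_def V_def S_def)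
  have VB: "V * B = 1\<^sub>m (n - 1)"
    using delete_row_right_inverse[of W i] right_inv assms by (simp add: B_def V_def S_def)
  have del: "delete_row W i = V" "delete_row T i = S * T" "delete_entry y i = S *\<^sub>v y"
    by (simp_all add: delete_row_eq_mult[of W] delete_row_eq_mult[of T] delete_entry_eq_mult V_def S_def)
  \<comment> \<open>With \<open>Z = B * S\<close>, the full-sample products in the claim are
    literally the leave-one-out products, so the formula for the unpenalized coefficients follows by
    unfolding.\<close>
  have ZT: "Z * T = B * (S * T)" by (simp add: Z mult_assoc_dim)
  have Zy: "Z *\<^sub>v y = B *\<^sub>v (S *\<^sub>v y)" by (simp add: Z mult_mat_vec_assoc_dim)
  have tau: "loo_tau W T y i = pinv (Z * T) *\<^sub>v (Z *\<^sub>v y)"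
    unfolding loo_tau_def prls_tau_def del B_def[symmetric] ZT Zy ..
  have VB': "V * pinv V = 1\<^sub>m (dim_row V)" using VB by (simp add: B_def)
  have dim: "dim_row (S * T) = dim_row V" by simp
  note RB = pinv_proj_perp_mult[OF VB' dim] proj_perp_pinv_mult_proj_perp[OF VB' dim]
    pinv_mult_proj_perp[OF VB' dim]
  note RB = RB[folded B_def, folded R_def]
  have [simp]: "dim_row (proj_perp (S * T)) = n - 1" "dim_col (proj_perp (S * T)) = n - 1"
    by (simp_all add: proj_perp_def proj_def)
  have "loo_lambda W T y i = R * B *\<^sub>v (proj_perp (S * T) *\<^sub>v (S *\<^sub>v y))"
    unfolding loo_lambda_def prls_lambda_def del RB ..
  \<comment> \<open>Regrouping exposes \<open>R * B * proj_perp (S * T)\<close>, which equals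
    \<open>R * B\<close>; the projection of the response is thus absorbed.\<close>
  also have "\<dots> = R * B * proj_perp (S * T) *\<^sub>v (S *\<^sub>v y)"
    by (rule mult_mat_vec_assoc_dim) simp_all
  finally have lam: "loo_lambda W T y i = R * B *\<^sub>v (S *\<^sub>v y)" unfolding RB .
  \<comment> \<open>The outer factors in the claim combine to the projection \<open>B * V\<close>
    onto the row space of \<open>V\<close>, which leaves \<open>R * B\<close> unchanged.\<close>
  have "W\<^sup>T * Z\<^sup>T = (B * V)\<^sup>T"
    by (simp add: Z V_def transpose_mult_dim mult_assoc_dim)
  then have WZ: "W\<^sup>T * Z\<^sup>T = B * V" by (simp add: B_def transpose_pinv_mult)
  have [simp]: "dim_row Z = q" "dim_col Z = n" by (simp_all add: Z)
  have "W\<^sup>T *\<^sub>v (Z\<^sup>T *\<^sub>v (R *\<^sub>v (B *\<^sub>v (S *\<^sub>v y)))) = B * V * R * B *\<^sub>v (S *\<^sub>v y)"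
    by (simp add: mult_mat_vec_assoc_dim WZ[symmetric] mult_assoc_dim)
  then have "W\<^sup>T *\<^sub>v (Z\<^sup>T *\<^sub>v (proj_perp (Z * T) *\<^sub>v (Z *\<^sub>v y))) = loo_lambda W T y i"
    unfolding RB lam ZT Zy R_def[symmetric] .
  with tau show ?thesis unfolding Z_def by simp
qed

end
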